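(* Let $m\ge 1$, let $\varrho=(\varrho_1,\dots,\varrho_m)$ be a vector of non-negative integers, and let $Q_\varrho=\prod_{j=1}^m\{0,1,\dots,\varrho_j\}$. For a subset $\mathcal C\subseteq Q_\varrho$, let $\check{\mathcal C}$ be its join-closure, obtained by taking the join of any set of elements of $\mathcal C$, and consider the following properties. (C1) $0\notin\mathcal C$. (C2) All elements of $\mathcal C$ are join-irreducible in $\mathcal C$. (C3) If $a\in\check{\mathcal C}$ and $i\in\{1,\dots,m\}$ is such that $a-e_i\in Q_\varrho$, then there exists $b\in\check{\mathcal C}\cup\{0\}$ such that $b\preceq a-e_i$ and $a$ covers $b$ in $\check{\mathcal C}\cup\{0\}$. (C* ) For every $i\in\{1,\dots,m\}$ and $t\in\{0,\dots,\varrho_i\}$, $t\,e_i\notin\mathcal C$. Then the set of circuits $\mathcal C$ of a matricube $\mathscr M$ with ground set $Q_\varrho$ satisfies (C1), (C2) and (C3). Conversely, if $\mathcal C\subseteq Q_\varrho$ satisfies (C1), (C2) and (C3), then $\mathcal C$ is the set of circuits of a matricube $\mathscr M$ with ground set $Q_\varrho$. Moreover, the matricube $\mathscr M$ is simple if and only if (C* ) holds.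
   Context: $Q_\varrho$ is ordered coordinatewise: $x\preceq y$ iff $x_j\le y_j$ for all $j$. The operations $\vee$ (join) and $\wedge$ (meet) are the coordinatewise maximum and minimum. $e_i$ is the $i$-th unit vector, $|x|_{\ell_1}=x_1+\dots+x_m$, and $x^c=\varrho-x$ is the complement of $x\in Q_\varrho$. A matricube $\mathscr M$ with ground set $Q_\varrho$ is given by a function $\mathbf r:Q_\varrho\to\mathbb Z$ (its rank function) such that: (R1) $\mathbf r(0)=0$ and $\mathbf r(t\,e_i)-\mathbf r((t-1)e_i)\le 1$ for all $1\le i\le m$ and $1\le t\le \varrho_i$; (R2) $x\preceq y$ implies $\mathbf r(x)\le\mathbf r(y)$; (R3) $\mathbf r(x)+\mathbf r(y)\ge \mathbf r(x\vee y)+\mathbf r(x\wedge y)$ for all $x,y\in Q_\varrho$. It is simple if $\varrho_i>0$ and $\mathbf r(t\,e_i)=t$ for all $i$ and all $t\in\{0,\dots,\varrho_i\}$. A point $a\in Q_\varrho$ is a flat if for every $i$ with $a+e_i\in Q_\varrho$ one has $\mathbf r(a+e_i)=\mathbf r(a)+1$. The dual matricube $\mathscr M^*$ is the matricube on $Q_\varrho$ with rank function $\mathbf r^*(x)=|x|_{\ell_1}+\mathbf r(x^c)-\mathbf r(\varrho)$. An element $a$ of a subset $\mathcal A\subseteq Q_\varrho$ is join-irreducible in $\mathcal A$ if it is not the join of any set of elements of $\mathcal A\setminus\{a\}$. The circuits of $\mathscr M$ are the nonzero join-irreducible elements of the set $\{a^c : a \text{ a flat of } \mathscr M^*\}$ (join-irreducible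 in that set). For a subset $\mathcal A\subseteq Q_\varrho$ with the induced order, $a$ covers $b$ in $\mathcal A$ if $a,b\in\mathcal A$, $b\prec a$, and there is no $c\in\mathcal A$ with $b\prec c\prec a$.
   Formalization: The "Moreover" is stated only when all ϱ_i > 0: simple requires ϱ_i > 0, so if some ϱ_i = 0 no matricube is simple, while (C* ) can still hold (e.g. ϱ = 0, where there are no circuits), and the equivalence as written fails. *)

theory Defs
  imports Main "HOL-Library.Function_Algebras"
begin

text \<open>
  Vectors with coordinates indexed by \<open>1, \<dots>, m\<close>, \<open>m \<ge> 1\<close>, are functions on a finite (hence
  nonempty) index type \<open>'i\<close>.  The order, \<open>sup\<close> (join), \<open>inf\<close> (meet), \<open>+\<close>, \<open>-\<close> and \<open>0\<close> on
  \<open>'i \<Rightarrow> nat\<close> are the pointwise ones of the library.  Subtraction on \<open>nat\<close> truncates; it is only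
  used below where it agrees with integer subtraction.
\<close>

definition hypercuboid :: "('i::finite \<Rightarrow> nat) \<Rightarrow> ('i \<Rightarrow> nat) set"
  where "hypercuboid \<rho> = {x. \<forall>j. x j \<le> \<rho> j}"

definition axis_point :: "'i::finite \<Rightarrow> nat \<Rightarrow> 'i \<Rightarrow> nat"
  where "axis_point i t = (\<lambda>j. if j = i then t else 0)"

definition unit_vec :: "'i::finite \<Rightarrow> 'i \<Rightarrow> nat"
  where "unit_vec i = axis_point i 1"

text \<open>Only the values of \<open>r\<close> on the hypercuboid are meaningful, here and in what follows.\<close>

definition matricube :: "('i::finite \<Rightarrow> nat) \<Rightarrow> (('i \<Rightarrow> nat) \<Rightarrow> int) \<Rightarrow> bool"
  where "matricube \<rho> r \<longleftrightarrow>
    r 0 = 0 \<and>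
    (\<forall>i t. 1 \<le> t \<and> t \<le> \<rho> i \<longrightarrow> r (axis_point i t) - r (axis_point i (t - 1)) \<le> 1) \<and>
    (\<forall>x\<in>hypercuboid \<rho>. \<forall>y\<in>hypercuboid \<rho>. x \<le> y \<longrightarrow> r x \<le> r y) \<and>
    (\<forall>x\<in>hypercuboid \<rho>. \<forall>y\<in>hypercuboid \<rho>. r x + r y \<ge> r (sup x y) + r (inf x y))"

text \<open>
  Condition \<open>\<rho> i > 0\<close> is a property of \<open>\<rho>\<close> alone that the circuits cannot detect: for \<open>\<rho> = 0\<close>
  the unique matricube is not simple, yet its set of circuits is empty.
\<close>

definition simple_matricube :: "('i::finite \<Rightarrow> nat) \<Rightarrow> (('i \<Rightarrow> nat) \<Rightarrow> int) \<Rightarrow> bool"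
  where "simple_matricube \<rho> r \<longleftrightarrow>
    matricube \<rho> r \<and> (\<forall>i. \<rho> i > 0 \<and> (\<forall>t\<le>\<rho> i. r (axis_point i t) = int t))"

definition flat :: "('i::finite \<Rightarrow> nat) \<Rightarrow> (('i \<Rightarrow> nat) \<Rightarrow> int) \<Rightarrow> ('i \<Rightarrow> nat) \<Rightarrow> bool"
  where "flat \<rho> r a \<longleftrightarrow> a \<in> hypercuboid \<rho> \<and>
    (\<forall>i. a + unit_vec i \<in> hypercuboid \<rho> \<longrightarrow> r (a + unit_vec i) = r a + 1)"

definition dual_rank ::
    "('i::finite \<Rightarrow> nat) \<Rightarrow> (('i \<Rightarrow> nat) \<Rightarrow> int) \<Rightarrow> ('i \<Rightarrow> nat) \<Rightarrow> int"
  where "dual_rank \<rho> r x = int (\<Sum>j\<in>UNIV. x j) + r (\<rho> - x) - r \<rho>"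

text \<open>
  \<open>Sup S\<close> is the coordinatewise supremum in \<open>nat\<close>, i.e. the coordinatewise maximum for the finite
  nonempty sets \<open>S\<close> (subsets of a hypercuboid) to which it is applied.  Joins are taken over
  nonempty sets, so \<open>0\<close> is not automatically a join.  Admitting the empty join \<open>0\<close> would change
  neither the circuits nor the conjunction of the circuit axioms below.
\<close>

definition join_irreducible :: "('i::finite \<Rightarrow> nat) set \<Rightarrow> ('i \<Rightarrow> nat) \<Rightarrow> bool"
  where "join_irreducible A a \<longleftrightarrow> a \<in> A \<and> \<not> (\<exists>S. S \<noteq> {} \<and> S \<subseteq> A - {a} \<and> a = Sup S)"

definition join_closure :: "('i::finite \<Rightarrow> nat) set \<Rightarrow> ('i \<Rightarrow> nat) set"
  where "join_closure A = {Sup S | S. S \<noteq> {} \<and> S \<subseteq> A}"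

definition circuits ::
    "('i::finite \<Rightarrow> nat) \<Rightarrow> (('i \<Rightarrow> nat) \<Rightarrow> int) \<Rightarrow> ('i \<Rightarrow> nat) set"
  where "circuits \<rho> r =
    {c. c \<noteq> 0 \<and> join_irreducible {\<rho> - a | a. flat \<rho> (dual_rank \<rho> r) a} c}"

definition covers_in :: "('i::finite \<Rightarrow> nat) set \<Rightarrow> ('i \<Rightarrow> nat) \<Rightarrow> ('i \<Rightarrow> nat) \<Rightarrow> bool"
  where "covers_in A a b \<longleftrightarrow> a \<in> A \<and> b \<in> A \<and> b < a \<and> \<not> (\<exists>c\<in>A. b < c \<and> c < a)"

definition circuit_C1 :: "('i::finite \<Rightarrow> nat) set \<Rightarrow> bool"
  where "circuit_C1 C \<longleftrightarrow> 0 \<notin> C"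

definition circuit_C2 :: "('i::finite \<Rightarrow> nat) set \<Rightarrow> bool"
  where "circuit_C2 C \<longleftrightarrow> (\<forall>c\<in>C. join_irreducible C c)"

text \<open>For \<open>a\<close> in the hypercuboid, \<open>a - e\<^sub>i\<close> lies in the hypercuboid iff \<open>a i \<ge> 1\<close>.\<close>

definition circuit_C3 :: "('i::finite \<Rightarrow> nat) set \<Rightarrow> bool"
  where "circuit_C3 C \<longleftrightarrow>
    (\<forall>a\<in>join_closure C. \<forall>i. a i \<ge> 1 \<longrightarrow>
      (\<exists>b\<in>join_closure C \<union> {0}.
        b \<le> a - unit_vec i \<and> covers_in (join_closure C \<union> {0}) a b))"

definition circuit_Cstar :: "('i::finite \<Rightarrow> nat) \<Rightarrow> ('i \<Rightarrow> nat) set \<Rightarrow> bool"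
  where "circuit_Cstar \<rho> C \<longleftrightarrow> (\<forall>i. \<forall>t\<le>\<rho> i. axis_point i t \<notin> C)"

end

theory Submission
  imports Defs "HOL-Library.FuncSet"
begin

text \<open>
  Two reformulations make the correspondence elementary.

  First, complementing turns the flats of the dual into the \<^emph>\<open>cyclic points\<close>: the points \<open>x\<close> such that
  lowering any positive coordinate by one leaves \<open>r\<close> unchanged (lemma \<open>complements_of_dual_flats\<close>).
  In terms of the nullity \<open>|x| - r x\<close>, which is monotone with unit steps equal to 0 or 1, a point
  is cyclic iff all steps down from it lower the nullity.

  Second, joins are handled one coordinate at a time: a nonzero point is a join of members of a
  finite set \<open>C\<close> iff each of its positive coordinates is attained by a member of \<open>C\<close> below it
  (\<open>join_closure_iff\<close>), and join-irreducibility means that in some coordinate the point is the only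
  such witness for itself (\<open>join_irreducible_iff\<close>). Consequently a finite join-closed set
  containing 0 and its set of nonzero join-irreducible elements determine each other
  (\<open>join_closure_irreducibles\<close>, \<open>irreducibles_join_closure\<close>), and the theorem becomes a statement
  about the set of cyclic points.

  Circuits satisfy (C3): starting from \<open>a - e\<^sub>i\<close>, step down as long as the nullity does not change.
  The end point \<open>b\<close> is cyclic and has nullity one less than \<open>a\<close>. As the nullity increases strictly
  along cyclic points, nothing cyclic fits strictly between \<open>b\<close> and \<open>a\<close>.

  Conversely, let \<open>C\<close> satisfy the axioms. If \<open>C\<close> is to be the set of circuits, then the step of the
  nullity from \<open>x - e\<^sub>i\<close> to \<open>x\<close> must be 1 exactly when some \<open>c \<in> C\<close> below \<open>x\<close> has \<open>c\<^sub>i = x\<^sub>i\<close>. Steps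
  prescribed in this way come from a function iff the two ways around each unit square give the
  same sum, and (C3) yields this (\<open>exchange\<close>, \<open>path_sum_step\<close>). Since witnesses persist
  when other coordinates grow, the steps are monotone in the other coordinates, so the nullity is
  supermodular and \<open>|x|\<close> minus it is submodular.

  Finally, if all \<open>\<rho>\<^sub>i\<close> are positive, a matricube fails to be simple iff some nonzero \<open>t e\<^sub>i\<close> is cyclic, and the circuits below
  such a point lie on the same axis.
\<close>

section \<open>Unit steps in the grid\<close>

lemma unit_vec_apply: "unit_vec i j = (if j = i then 1 else 0)"
  by (simp add: unit_vec_def axis_point_def)

lemma le_minus_unit_vec_iff:
  assumes "1 \<le> x i"
  shows "u \<le> x - unit_vec i \<longleftrightarrow> u \<le> x \<and> u i < x i"
proof
  assume h: "u \<le> x - unit_vec i"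
  have "u j \<le> x j" for j
    using le_funD[OF h, of j] by (simp add: unit_vec_apply split: if_splits)
  moreover have "u i < x i"
    using le_funD[OF h, of i] assms by (simp add: unit_vec_apply)
  ultimately show "u \<le> x \<and> u i < x i" by (simp add: le_fun_def)
next
  assume "u \<le> x \<and> u i < x i"
  then show "u \<le> x - unit_vec i"
    by (auto simp: le_fun_def unit_vec_apply)
qed

lemma minus_unit_vec_le: "x - unit_vec i \<le> x"
  by (simp add: le_fun_def unit_vec_apply)

lemma less_imp_le_minus_unit_vec:
  fixes u x :: "'i::finite \<Rightarrow> nat"
  assumes "u < x"
  obtains i where "1 \<le> x i" "u \<le> x - unit_vec i"
proof -
  have le: "u \<le> x" and "\<not> x \<le> u" using assms by (simp_all add: less_le_not_le)
  then obtain i where "u i < x i" by (auto simp: le_fun_def not_le)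
  then have "1 \<le> x i" and "u i < x i" by simp_all
  then show thesis using that le_minus_unit_vec_iff le by blast
qed

lemma nonzero_imp_positive_coordinate:
  fixes x :: "'i::finite \<Rightarrow> nat"
  assumes "x \<noteq> 0"
  obtains i where "1 \<le> x i"
proof -
  have "\<exists>i. x i \<noteq> 0" using assms by (auto simp: fun_eq_iff)
  then show thesis using that by (auto simp: Suc_le_eq)
qed

lemma sum_minus_unit_vec:
  assumes "1 \<le> x i"
  shows "(\<Sum>j\<in>UNIV. x j) = Suc (\<Sum>j\<in>UNIV. (x - unit_vec i) j)"
proof -
  have "(\<Sum>j\<in>UNIV. x j) = x i + (\<Sum>j\<in>UNIV - {i}. x j)"
    by (simp add: sum.remove[of UNIV i])
  moreover have "(\<Sum>j\<in>UNIV - {i}. (x - unit_vec i) j) = (\<Sum>j\<in>UNIV - {i}. x j)"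
    by (rule sum.cong) (simp_all add: unit_vec_apply)
  then have "(\<Sum>j\<in>UNIV. (x - unit_vec i) j) = (x i - 1) + (\<Sum>j\<in>UNIV - {i}. x j)"
    by (simp add: sum.remove[of UNIV i] unit_vec_apply)
  ultimately show ?thesis using assms by simp
qed

lemma hypercuboid_downward:
  "x \<in> hypercuboid \<rho> \<Longrightarrow> y \<le> x \<Longrightarrow> y \<in> hypercuboid \<rho>"
  unfolding hypercuboid_def le_fun_def by (auto intro: order_trans)

lemma finite_hypercuboid: "finite (hypercuboid (\<rho> :: 'i::finite \<Rightarrow> nat))"
proof -
  have "hypercuboid \<rho> = PiE UNIV (\<lambda>j. {..\<rho> j})"
    by (auto simp: hypercuboid_def PiE_def)
  then show ?thesis by (simp add: finite_PiE)
qed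

lemma axis_point_minus_unit_vec: "axis_point i t - unit_vec i = axis_point i (t - 1)"
  by (auto simp: fun_eq_iff axis_point_def unit_vec_apply)

lemma axis_point_in_hypercuboid: "t \<le> \<rho> i \<Longrightarrow> axis_point i t \<in> hypercuboid \<rho>"
  by (simp add: hypercuboid_def axis_point_def)

lemma axis_point_0: "axis_point i 0 = 0"
  by (simp add: fun_eq_iff axis_point_def)

section \<open>Joins, one coordinate at a time\<close>

definition attained :: "('i \<Rightarrow> nat) set \<Rightarrow> 'i \<Rightarrow> ('i \<Rightarrow> nat) \<Rightarrow> bool"
  where "attained A i x \<longleftrightarrow> (\<exists>c\<in>A. c \<le> x \<and> c i = x i)"

lemma Sup_upper_fun:
  fixes S :: "('i \<Rightarrow> nat) set"
  assumes "finite S" "u \<in> S"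
  shows "u \<le> Sup S"
  using assms by (auto simp: le_fun_def intro!: cSup_upper bdd_above_finite)

lemma Sup_least_fun:
  fixes S :: "('i \<Rightarrow> nat) set"
  assumes "S \<noteq> {}" "\<And>u. u \<in> S \<Longrightarrow> u \<le> b"
  shows "Sup S \<le> b"
  using assms by (auto simp: le_fun_def intro!: cSup_least)

lemma Sup_attained:
  fixes S :: "('i \<Rightarrow> nat) set"
  assumes "finite S" "S \<noteq> {}"
  shows "attained S i (Sup S)"
proof -
  have "(\<lambda>u. u i) ` S \<noteq> {}" "finite ((\<lambda>u. u i) ` S)" using assms by auto
  then have "Sup ((\<lambda>u. u i) ` S) \<in> (\<lambda>u. u i) ` S"
    by (metis cSup_eq_Max Max_in)
  then have "\<exists>u\<in>S. u i = Sup S i" by auto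
  then show ?thesis using Sup_upper_fun[OF assms(1)] by (auto simp: attained_def)
qed

lemma Sup_eqI_attained:
  fixes S :: "('i \<Rightarrow> nat) set"
  assumes "finite S" "S \<noteq> {}" "\<And>u. u \<in> S \<Longrightarrow> u \<le> x"
    and att: "\<And>i. 1 \<le> x i \<Longrightarrow> \<exists>u\<in>S. u i = x i"
  shows "Sup S = x"
proof (rule antisym)
  show "Sup S \<le> x" using Sup_least_fun assms by blast
  show "x \<le> Sup S"
  proof (rule le_funI)
    fix i
    show "x i \<le> Sup S i"
    proof (cases "1 \<le> x i")
      case True
      then obtain u where "u \<in> S" "u i = x i" using att by blast
      then show ?thesis using le_funD[OF Sup_upper_fun[OF assms(1)], of u i] by simp
    qed simp
  qed
qed

text \<open>
  This turns the second-order closure under joins of sets into a first-order condition, which is how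
  all join-closed sets are treated from here on.
\<close>

lemma join_closure_iff:
  fixes C :: "('i::finite \<Rightarrow> nat) set"
  assumes "finite C"
  shows "x \<in> join_closure C \<union> {0} \<longleftrightarrow> (\<forall>i. 1 \<le> x i \<longrightarrow> attained C i x)"
proof
  assume "x \<in> join_closure C \<union> {0}"
  then consider "x = 0" | S where "x = Sup S" "S \<noteq> {}" "S \<subseteq> C"
    by (auto simp: join_closure_def)
  then show "\<forall>i. 1 \<le> x i \<longrightarrow> attained C i x"
  proof cases
    case 2
    then have "finite S" using assms finite_subset by blast
    then show ?thesis using Sup_attained[of S] 2 unfolding attained_def by blast
  qed simp
next
  assume att: "\<forall>i. 1 \<le> x i \<longrightarrow> attained C i x"
  show "x \<in> join_closure C \<union> {0}"
  proof (cases "x = 0")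
    case False
    let ?S = "{c \<in> C. c \<le> x}"
    obtain i where "1 \<le> x i" using False by (rule nonzero_imp_positive_coordinate)
    then have "?S \<noteq> {}" using att by (auto simp: attained_def)
    moreover from this have "Sup ?S = x"
      using assms att by (intro Sup_eqI_attained) (auto simp: attained_def)
    moreover have "?S \<subseteq> C" by blast
    ultimately have "\<exists>S. x = Sup S \<and> S \<noteq> {} \<and> S \<subseteq> C" by metis
    then show ?thesis by (simp add: join_closure_def)
  qed simp
qed

lemma join_irreducible_in: "join_irreducible A a \<Longrightarrow> a \<in> A"
  unfolding join_irreducible_def by (rule conjunct1)

lemma join_irreducible_iff:
  fixes A :: "('i::finite \<Rightarrow> nat) set"
  assumes "finite A" "a \<noteq> 0"
  shows "join_irreducible A a \<longleftrightarrow>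
    a \<in> A \<and> (\<exists>i. 1 \<le> a i \<and> (\<forall>c\<in>A. c \<le> a \<and> c i = a i \<longrightarrow> c = a))"
proof
  assume irr: "join_irreducible A a"
  show "a \<in> A \<and> (\<exists>i. 1 \<le> a i \<and> (\<forall>c\<in>A. c \<le> a \<and> c i = a i \<longrightarrow> c = a))"
  proof (rule ccontr)
    let ?S = "{c \<in> A - {a}. c \<le> a}"
    have "a \<in> A" using irr by (simp add: join_irreducible_def)
    moreover assume "\<not> ?thesis"
    ultimately have att: "\<exists>c\<in>?S. c i = a i" if "1 \<le> a i" for i
      using that by blast
    obtain i where "1 \<le> a i" using assms(2) by (rule nonzero_imp_positive_coordinate)
    then have "?S \<noteq> {}" using att by blast
    moreover from this have "Sup ?S = a"
      using att assms(1) by (intro Sup_eqI_attained) auto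
    moreover have "?S \<subseteq> A - {a}" by blast
    ultimately have "\<exists>S. S \<noteq> {} \<and> S \<subseteq> A - {a} \<and> a = Sup S" by metis
    then show False using irr by (simp add: join_irreducible_def)
  qed
next
  assume R: "a \<in> A \<and> (\<exists>i. 1 \<le> a i \<and> (\<forall>c\<in>A. c \<le> a \<and> c i = a i \<longrightarrow> c = a))"
  then obtain i where i: "\<And>c. c \<in> A \<Longrightarrow> c \<le> a \<Longrightarrow> c i = a i \<Longrightarrow> c = a" by blast
  have False if S: "S \<noteq> {}" "S \<subseteq> A - {a}" "a = Sup S" for S
  proof -
    have "finite S" using S(2) assms(1) by (meson finite_Diff finite_subset)
    then obtain c where "c \<in> S" "c \<le> a" "c i = a i"
      using Sup_attained[of S i] S(1) unfolding attained_def S(3)[symmetric] by blast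
    then show False using i[of c] S(2) by blast
  qed
  then have "\<not> (\<exists>S. S \<noteq> {} \<and> S \<subseteq> A - {a} \<and> a = Sup S)" by metis
  then show "join_irreducible A a" using R by (simp add: join_irreducible_def)
qed

lemma join_irreducible_subset:
  assumes "join_irreducible A a" "a \<in> B" "B \<subseteq> A"
  shows "join_irreducible B a"
proof -
  have "S \<subseteq> A - {a}" if "S \<subseteq> B - {a}" for S using that assms(3) by blast
  then show ?thesis using assms(1,2) unfolding join_irreducible_def by metis
qed

text \<open>
  A witness for a coordinate of \<open>x\<close> can be taken join-irreducible: if \<open>x\<close> itself is not, replace it by
  a smaller witness and continue.
\<close>

lemma attained_by_irreducible:
  fixes U :: "('i::finite \<Rightarrow> nat) set"
  assumes "finite U" "x \<in> U" "1 \<le> x i"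
  shows "attained {c. c \<noteq> 0 \<and> join_irreducible U c} i x"
  using assms(2,3)
proof (induction "\<Sum>j\<in>UNIV. x j" arbitrary: x rule: less_induct)
  case less
  have nz: "x \<noteq> 0" using less.prems(2) by auto
  show ?case
  proof (cases "join_irreducible U x")
    case True
    then show ?thesis using nz by (auto simp: attained_def)
  next
    case False
    then obtain u where u: "u \<in> U" "u \<le> x" "u i = x i" "u \<noteq> x"
      using join_irreducible_iff[OF assms(1) nz] less.prems by blast
    then have "u < x" by simp
    then obtain j where "1 \<le> x j" "u \<le> x - unit_vec j"
      by (rule less_imp_le_minus_unit_vec)
    then have "(\<Sum>j\<in>UNIV. u j) < (\<Sum>j\<in>UNIV. x j)"
      using sum_minus_unit_vec[of x j] sum_mono[of UNIV u "x - unit_vec j"]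
      by (simp add: le_fun_def)
    then have "attained {c. c \<noteq> 0 \<and> join_irreducible U c} i u"
      using less.hyps[of u] u less.prems by simp
    then show ?thesis using u unfolding attained_def by (metis order_trans)
  qed
qed

lemma join_closure_irreducibles:
  fixes U :: "('i::finite \<Rightarrow> nat) set"
  assumes "finite U"
    and closed: "\<And>x. (\<And>i. 1 \<le> x i \<Longrightarrow> attained U i x) \<Longrightarrow> x \<in> U"
  shows "join_closure {c. c \<noteq> 0 \<and> join_irreducible U c} \<union> {0} = U"
    (is "join_closure ?C \<union> {0} = U")
proof -
  have "?C \<subseteq> U" using join_irreducible_in by blast
  then have fin: "finite ?C" using assms(1) finite_subset by blast
  have "x \<in> join_closure ?C \<union> {0} \<longleftrightarrow> x \<in> U" for x
  proof
    assume "x \<in> join_closure ?C \<union> {0}"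
    then have "\<forall>i. 1 \<le> x i \<longrightarrow> attained ?C i x"
      using join_closure_iff[OF fin] by blast
    then show "x \<in> U"
      using \<open>?C \<subseteq> U\<close> by (intro closed) (auto simp: attained_def)
  next
    assume "x \<in> U"
    then show "x \<in> join_closure ?C \<union> {0}"
      using attained_by_irreducible[OF assms(1)] join_closure_iff[OF fin] by blast
  qed
  then show ?thesis by blast
qed

text \<open>
  Both inclusions compare attainment by \<open>C\<close> with attainment by its join-closure: each member of the
  closure attains its positive coordinates through members of \<open>C\<close> below it.
\<close>

lemma irreducibles_join_closure:
  fixes C :: "('i::finite \<Rightarrow> nat) set"
  assumes "finite C" "0 \<notin> C" "\<And>c. c \<in> C \<Longrightarrow> join_irreducible C c"
    and fin: "finite (join_closure C \<union> {0})"
  shows "{c. c \<noteq> 0 \<and> join_irreducible (join_closure C \<union> {0}) c} = C"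
    (is "{c. c \<noteq> 0 \<and> join_irreducible ?U c} = C")
proof -
  have sub: "C \<subseteq> ?U" using join_closure_iff[OF assms(1)] by (auto simp: attained_def)
  show ?thesis
  proof (intro set_eqI iffI)
    fix c assume "c \<in> {c. c \<noteq> 0 \<and> join_irreducible ?U c}"
    then obtain i where c: "c \<in> ?U" and i: "1 \<le> c i"
      and only: "\<And>u. u \<in> ?U \<Longrightarrow> u \<le> c \<Longrightarrow> u i = c i \<Longrightarrow> u = c"
      using join_irreducible_iff[OF fin] by blast
    have "attained C i c" using c i join_closure_iff[OF assms(1)] by blast
    then show "c \<in> C" using only sub by (auto simp: attained_def)
  next
    fix c assume c: "c \<in> C"
    then have nz: "c \<noteq> 0" using assms(2) by metis
    obtain i where i: "1 \<le> c i"
      and only: "\<And>u. u \<in> C \<Longrightarrow> u \<le> c \<Longrightarrow> u i = c i \<Longrightarrow> u = c"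
      using join_irreducible_iff[OF assms(1) nz] assms(3)[OF c] by blast
    have "u = c" if u: "u \<in> ?U" "u \<le> c" "u i = c i" for u
    proof -
      have "attained C i u" using u i join_closure_iff[OF assms(1), of u] by simp
      then obtain v where "v \<in> C" "v \<le> u" "v i = u i" by (auto simp: attained_def)
      moreover from this have "v = c" using only[of v] u by auto
      ultimately show "u = c" using u(2) by simp
    qed
    then have "join_irreducible ?U c"
      using join_irreducible_iff[OF fin nz] i c sub by blast
    then show "c \<in> {c. c \<noteq> 0 \<and> join_irreducible ?U c}" using nz by blast
  qed
qed

section \<open>Cyclic points\<close>

definition cyclic_points ::
    "('i::finite \<Rightarrow> nat) \<Rightarrow> (('i \<Rightarrow> nat) \<Rightarrow> int) \<Rightarrow> ('i \<Rightarrow> nat) set"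
  where "cyclic_points \<rho> r =
    {x \<in> hypercuboid \<rho>. \<forall>i. 1 \<le> x i \<longrightarrow> r (x - unit_vec i) = r x}"

text \<open>
  Going up from \<open>\<rho> - x\<close> in direction \<open>i\<close> is going down from \<open>x\<close>; the step of the dual rank is 1
  minus the step of the rank, so it equals 1 exactly if the rank does not change.
\<close>

lemma complements_of_dual_flats:
  fixes \<rho> :: "'i::finite \<Rightarrow> nat"
  shows "{\<rho> - a | a. flat \<rho> (dual_rank \<rho> r) a} = cyclic_points \<rho> r"
proof -
  have flat_iff: "flat \<rho> (dual_rank \<rho> r) (\<rho> - x) \<longleftrightarrow> x \<in> cyclic_points \<rho> r"
    if x: "x \<in> hypercuboid \<rho>" for x
  proof -
    have le: "x j \<le> \<rho> j" for j using x by (simp add: hypercuboid_def)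
    have cc: "\<rho> - (\<rho> - x) = x" using le by (simp add: fun_eq_iff)
    have mem: "\<rho> - x + unit_vec i \<in> hypercuboid \<rho> \<longleftrightarrow> 1 \<le> x i" for i
    proof
      assume "\<rho> - x + unit_vec i \<in> hypercuboid \<rho>"
      then have "(\<rho> - x + unit_vec i) i \<le> \<rho> i" by (simp add: hypercuboid_def)
      then show "1 \<le> x i" using le[of i] by (simp add: unit_vec_apply)
    next
      assume "1 \<le> x i"
      then show "\<rho> - x + unit_vec i \<in> hypercuboid \<rho>"
        using le[of i] by (auto simp: hypercuboid_def unit_vec_apply)
    qed
    have step: "dual_rank \<rho> r (\<rho> - x + unit_vec i) = dual_rank \<rho> r (\<rho> - x) + 1
        \<longleftrightarrow> r (x - unit_vec i) = r x" if i: "1 \<le> x i" for i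
    proof -
      have c: "\<rho> - (\<rho> - x + unit_vec i) = x - unit_vec i"
      proof (rule ext)
        fix j
        show "(\<rho> - (\<rho> - x + unit_vec i)) j = (x - unit_vec i) j"
          using le[of j] i by (auto simp: unit_vec_apply)
      qed
      have "(\<Sum>j\<in>UNIV. (\<rho> - x + unit_vec i) j) = (\<Sum>j\<in>UNIV. (\<rho> - x) j) + 1"
        by (simp add: sum.distrib unit_vec_apply)
      then show ?thesis unfolding dual_rank_def c cc by auto
    qed
    have "\<rho> - x \<in> hypercuboid \<rho>" by (simp add: hypercuboid_def)
    then show ?thesis using mem step x by (auto simp: flat_def cyclic_points_def)
  qed
  show ?thesis
  proof (intro set_eqI iffI)
    fix x assume "x \<in> {\<rho> - a | a. flat \<rho> (dual_rank \<rho> r) a}"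
    then obtain a where a: "x = \<rho> - a" "flat \<rho> (dual_rank \<rho> r) a" by blast
    then have "\<rho> - x = a" by (simp add: flat_def hypercuboid_def fun_eq_iff)
    moreover have "x \<in> hypercuboid \<rho>" using a by (simp add: hypercuboid_def)
    ultimately show "x \<in> cyclic_points \<rho> r" using a flat_iff by blast
  next
    fix x assume x: "x \<in> cyclic_points \<rho> r"
    then have Q: "x \<in> hypercuboid \<rho>" by (simp add: cyclic_points_def)
    then have "x = \<rho> - (\<rho> - x)" by (simp add: hypercuboid_def fun_eq_iff)
    then show "x \<in> {\<rho> - a | a. flat \<rho> (dual_rank \<rho> r) a}"
      using flat_iff[OF Q] x by blast
  qed
qed

lemma circuits_eq: "circuits \<rho> r = {c. c \<noteq> 0 \<and> join_irreducible (cyclic_points \<rho> r) c}"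
  unfolding circuits_def complements_of_dual_flats ..

lemma finite_cyclic_points: "finite (cyclic_points \<rho> r)"
  using finite_hypercuboid[of \<rho>] by (simp add: cyclic_points_def)

lemma circuits_subset: "circuits \<rho> r \<subseteq> cyclic_points \<rho> r"
  unfolding circuits_eq using join_irreducible_in by blast

lemma matricube_mono:
  "matricube \<rho> r \<Longrightarrow> x \<in> hypercuboid \<rho> \<Longrightarrow> y \<in> hypercuboid \<rho> \<Longrightarrow> x \<le> y \<Longrightarrow> r x \<le> r y"
  by (simp add: matricube_def)

lemma matricube_submodular:
  "matricube \<rho> r \<Longrightarrow> x \<in> hypercuboid \<rho> \<Longrightarrow> y \<in> hypercuboid \<rho> \<Longrightarrow>
    r (sup x y) + r (inf x y) \<le> r x + r y"
  by (simp add: matricube_def)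

text \<open>
  Submodularity says that steps in a direction shrink when other coordinates grow. Comparing
  with a lower point having the same coordinate in this direction gives both the bound on all
  unit steps (compare with the axis) and the closure of cyclic points under joins.
\<close>

lemma matricube_step_antitone:
  assumes m: "matricube \<rho> r" and x: "x \<in> hypercuboid \<rho>" and c: "c \<le> x" "c i = x i" "1 \<le> x i"
  shows "r x - r (x - unit_vec i) \<le> r c - r (c - unit_vec i)"
proof -
  have le: "c j \<le> x j" for j using c(1) by (simp add: le_fun_def)
  have "sup c (x - unit_vec i) = x"
    using le c by (auto simp: fun_eq_iff unit_vec_apply sup_absorb1 sup_absorb2)
  moreover have "inf c (x - unit_vec i) = c - unit_vec i"
    using le c by (auto simp: fun_eq_iff unit_vec_apply inf_absorb1 inf_absorb2)
  moreover have "c \<in> hypercuboid \<rho>" "x - unit_vec i \<in> hypercuboid \<rho>"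
    using x c(1) hypercuboid_downward minus_unit_vec_le by blast+
  ultimately show ?thesis
    using matricube_submodular[OF m, of c "x - unit_vec i"] by simp
qed

lemma matricube_step_le_1:
  assumes m: "matricube \<rho> r" and x: "x \<in> hypercuboid \<rho>" and i: "1 \<le> x i"
  shows "r x \<le> r (x - unit_vec i) + 1"
proof -
  have "axis_point i (x i) \<le> x" "axis_point i (x i) i = x i"
    by (simp_all add: le_fun_def axis_point_def)
  then have "r x - r (x - unit_vec i)
      \<le> r (axis_point i (x i)) - r (axis_point i (x i - 1))"
    using matricube_step_antitone[OF m x, of "axis_point i (x i)" i] i axis_point_minus_unit_vec[of i "x i"] by fastforce
  also have "\<dots> \<le> 1" using m i x by (simp add: matricube_def hypercuboid_def)
  finally show ?thesis by simp
qed

lemma cyclic_points_join_closed: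
  assumes m: "matricube \<rho> r"
    and att: "\<And>i. 1 \<le> x i \<Longrightarrow> attained (cyclic_points \<rho> r) i x"
  shows "x \<in> cyclic_points \<rho> r"
proof -
  have "x j \<le> \<rho> j" for j
    using att[of j] by (cases "1 \<le> x j") (auto simp: attained_def cyclic_points_def hypercuboid_def,
        metis)
  then have x: "x \<in> hypercuboid \<rho>" by (simp add: hypercuboid_def)
  have "r (x - unit_vec i) = r x" if i: "1 \<le> x i" for i
  proof (rule antisym)
    show "r (x - unit_vec i) \<le> r x"
      using matricube_mono[OF m _ x] hypercuboid_downward[OF x] minus_unit_vec_le by blast
    obtain c where c: "c \<in> cyclic_points \<rho> r" "c \<le> x" "c i = x i"
      using att[OF i] by (auto simp: attained_def)
    then have "r (c - unit_vec i) = r c" using i by (simp add: cyclic_points_def)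
    then show "r x \<le> r (x - unit_vec i)" using matricube_step_antitone[OF m x, of c i] c(2,3) i by simp
  qed
  then show ?thesis using x by (simp add: cyclic_points_def)
qed

lemma join_closure_circuits:
  assumes "matricube \<rho> r"
  shows "join_closure (circuits \<rho> r) \<union> {0} = cyclic_points \<rho> r"
  unfolding circuits_eq
  by (rule join_closure_irreducibles[OF finite_cyclic_points cyclic_points_join_closed[OF assms]])

section \<open>Nullity and the circuit axioms\<close>

definition nullity :: "(('i::finite \<Rightarrow> nat) \<Rightarrow> int) \<Rightarrow> ('i \<Rightarrow> nat) \<Rightarrow> int"
  where "nullity r x = int (\<Sum>j\<in>UNIV. x j) - r x"

lemma nullity_minus_unit_vec:
  "1 \<le> x i \<Longrightarrow> nullity r x = nullity r (x - unit_vec i) + 1 - (r x - r (x - unit_vec i))"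
  using sum_minus_unit_vec[of x i] by (simp add: nullity_def)

lemma nullity_mono:
  assumes m: "matricube \<rho> r" and "x \<in> hypercuboid \<rho>" "u \<le> x"
  shows "nullity r u \<le> nullity r x"
  using assms(2,3)
proof (induction "\<Sum>j\<in>UNIV. x j" arbitrary: x rule: less_induct)
  case less
  show ?case
  proof (cases "u = x")
    case False
    then have "u < x" using less.prems by simp
    then obtain i where i: "1 \<le> x i" "u \<le> x - unit_vec i"
      by (rule less_imp_le_minus_unit_vec)
    have "nullity r u \<le> nullity r (x - unit_vec i)"
      using less.hyps[of "x - unit_vec i"] sum_minus_unit_vec[of x i] i
        hypercuboid_downward[OF less.prems(1) minus_unit_vec_le] by simp
    also have "\<dots> \<le> nullity r x"
      using nullity_minus_unit_vec[of x i r] matricube_step_le_1[OF m less.prems(1), of i] i(1)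
      by simp
    finally show ?thesis .
  qed simp
qed

lemma nullity_strict_below_cyclic:
  assumes m: "matricube \<rho> r" and a: "a \<in> cyclic_points \<rho> r" and "u < a"
  shows "nullity r u < nullity r a"
proof -
  obtain i where i: "1 \<le> a i" "u \<le> a - unit_vec i"
    using assms(3) by (rule less_imp_le_minus_unit_vec)
  have "a - unit_vec i \<in> hypercuboid \<rho>"
    using a hypercuboid_downward minus_unit_vec_le unfolding cyclic_points_def by blast
  then have "nullity r u \<le> nullity r (a - unit_vec i)" using nullity_mono[OF m] i by blast
  also have "\<dots> < nullity r a"
    using nullity_minus_unit_vec[of a i r] a i by (simp add: cyclic_points_def)
  finally show ?thesis .
qed

text \<open>A point that is not cyclic has a step down with rank step 1, which keeps the nullity.\<close>

lemma ex_cyclic_same_nullity: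
  assumes m: "matricube \<rho> r" and "x \<in> hypercuboid \<rho>"
  shows "\<exists>u\<in>cyclic_points \<rho> r. u \<le> x \<and> nullity r u = nullity r x"
  using assms(2)
proof (induction "\<Sum>j\<in>UNIV. x j" arbitrary: x rule: less_induct)
  case less
  show ?case
  proof (cases "x \<in> cyclic_points \<rho> r")
    case False
    then obtain i where i: "1 \<le> x i" "r (x - unit_vec i) \<noteq> r x"
      using less.prems by (auto simp: cyclic_points_def)
    have Q: "x - unit_vec i \<in> hypercuboid \<rho>"
      using less.prems hypercuboid_downward minus_unit_vec_le by blast
    have "r (x - unit_vec i) \<le> r x"
      using matricube_mono[OF m Q less.prems minus_unit_vec_le] .
    then have "r x = r (x - unit_vec i) + 1"
      using matricube_step_le_1[OF m less.prems, of i] i by simp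
    then have "nullity r (x - unit_vec i) = nullity r x"
      using nullity_minus_unit_vec[of x i r] i(1) by simp
    moreover obtain u where "u \<in> cyclic_points \<rho> r" "u \<le> x - unit_vec i"
        "nullity r u = nullity r (x - unit_vec i)"
      using less.hyps[OF _ Q] sum_minus_unit_vec[of x i] i(1) by auto
    ultimately show ?thesis using minus_unit_vec_le order_trans by metis
  qed auto
qed

text \<open>
  The nullities of \<open>b\<close> and \<open>a\<close> differ by 1 only, which leaves no room for a third cyclic point.
\<close>

lemma cyclic_points_cover:
  assumes m: "matricube \<rho> r" and a: "a \<in> cyclic_points \<rho> r" and i: "1 \<le> a i"
  shows "\<exists>b\<in>cyclic_points \<rho> r. b \<le> a - unit_vec i \<and> covers_in (cyclic_points \<rho> r) a b"
proof -
  have "a - unit_vec i \<in> hypercuboid \<rho>"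
    using a hypercuboid_downward minus_unit_vec_le unfolding cyclic_points_def by blast
  then obtain b where b: "b \<in> cyclic_points \<rho> r" "b \<le> a - unit_vec i"
      "nullity r b = nullity r (a - unit_vec i)"
    using ex_cyclic_same_nullity[OF m] by blast
  have eq: "nullity r a = nullity r b + 1"
    using nullity_minus_unit_vec[of a i r] a i b(3) by (simp add: cyclic_points_def)
  have "b \<le> a" "b \<noteq> a" using b(2) le_minus_unit_vec_iff[of a i b, OF i] by auto
  then have "b < a" by simp
  moreover have False if c: "c \<in> cyclic_points \<rho> r" "b < c" "c < a" for c
    using nullity_strict_below_cyclic[OF m c(1,2)] nullity_strict_below_cyclic[OF m a c(3)] eq
    by simp
  ultimately have "covers_in (cyclic_points \<rho> r) a b"
    using a b(1) by (auto simp: covers_in_def)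
  then show ?thesis using b by blast
qed

lemma circuit_axioms:
  assumes "matricube \<rho> r"
  shows "circuit_C1 (circuits \<rho> r)" "circuit_C2 (circuits \<rho> r)" "circuit_C3 (circuits \<rho> r)"
proof -
  show "circuit_C1 (circuits \<rho> r)" by (simp add: circuit_C1_def circuits_eq)
  show "circuit_C2 (circuits \<rho> r)"
    unfolding circuit_C2_def
    using join_irreducible_subset[OF _ _ circuits_subset, of \<rho> r] by (simp add: circuits_eq)
  show "circuit_C3 (circuits \<rho> r)"
    unfolding circuit_C3_def join_closure_circuits[OF assms]
    using cyclic_points_cover[OF assms] join_closure_circuits[OF assms] by blast
qed

section \<open>Functions with prescribed unit steps\<close>

function path_sum :: "('i::finite \<Rightarrow> ('i \<Rightarrow> nat) \<Rightarrow> int) \<Rightarrow> ('i \<Rightarrow> nat) \<Rightarrow> int"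
  where "path_sum d x =
    (if x = 0 then 0
     else path_sum d (x - unit_vec (SOME i. 1 \<le> x i)) + d (SOME i. 1 \<le> x i) x)"
  by auto
termination
proof (relation "measure (\<lambda>(d, x). \<Sum>j\<in>UNIV. x j)")
  fix d :: "'i::finite \<Rightarrow> ('i \<Rightarrow> nat) \<Rightarrow> int" and x :: "'i \<Rightarrow> nat"
  assume "x \<noteq> 0"
  then have "1 \<le> x (SOME i. 1 \<le> x i)"
    by (metis nonzero_imp_positive_coordinate someI_ex)
  from sum_minus_unit_vec[of x, OF this]
  show "((d, x - unit_vec (SOME i. 1 \<le> x i)), (d, x)) \<in> measure (\<lambda>(d, x). \<Sum>j\<in>UNIV. x j)"
    by simp
qed simp

declare path_sum.simps [simp del]

text \<open>
  The discrete Poincare lemma: steps whose sums around all unit squares agree are the steps of a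
  function. Summing along the path that always picks an arbitrary positive coordinate works for the
  picked direction by construction; any other direction is reached through a unit square and the
  induction hypothesis on two of its sides.
\<close>

lemma path_sum_step:
  fixes d :: "'i::finite \<Rightarrow> ('i \<Rightarrow> nat) \<Rightarrow> int"
  assumes closed: "\<And>i j x. i \<noteq> j \<Longrightarrow> 1 \<le> x i \<Longrightarrow> 1 \<le> x j \<Longrightarrow>
      d i x + d j (x - unit_vec i) = d j x + d i (x - unit_vec j)"
    and "1 \<le> x j"
  shows "path_sum d x = path_sum d (x - unit_vec j) + d j x"
  using assms(2)
proof (induction "\<Sum>j\<in>UNIV. x j" arbitrary: x j rule: less_induct)
  case less
  define i where "i = (SOME i. 1 \<le> x i)"
  have i: "1 \<le> x i" unfolding i_def using less.prems by (rule someI)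
  have "x \<noteq> 0" using less.prems by auto
  then have eq: "path_sum d x = path_sum d (x - unit_vec i) + d i x"
    by (subst path_sum.simps) (simp add: i_def)
  show ?case
  proof (cases "i = j")
    case False
    have "1 \<le> (x - unit_vec i) j" "1 \<le> (x - unit_vec j) i"
      using False i less.prems by (simp_all add: unit_vec_apply)
    then have "path_sum d (x - unit_vec i)
        = path_sum d (x - unit_vec i - unit_vec j) + d j (x - unit_vec i)"
      and "path_sum d (x - unit_vec j)
        = path_sum d (x - unit_vec j - unit_vec i) + d i (x - unit_vec j)"
      using less.hyps sum_minus_unit_vec i less.prems by (metis lessI)+
    moreover have "x - unit_vec i - unit_vec j = x - unit_vec j - unit_vec i"
      by (simp add: fun_eq_iff unit_vec_apply)
    ultimately show ?thesis using eq closed[of i j x] False i less.prems by simp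
  qed (use eq in simp)
qed

text \<open>
  Lower \<open>x\<close> towards the meet along a direction \<open>i\<close> with \<open>y i < x i\<close>: the meet stays, the join is lowered
  in the same direction from the same level, and its step is at least as large.
\<close>

lemma supermodular_if_steps_mono:
  fixes n :: "('i::finite \<Rightarrow> nat) \<Rightarrow> int"
  assumes step: "\<And>i x. 1 \<le> x i \<Longrightarrow> n x = n (x - unit_vec i) + d i x"
    and mono: "\<And>i x y. 1 \<le> x i \<Longrightarrow> x \<le> y \<Longrightarrow> x i = y i \<Longrightarrow> d i x \<le> d i y"
  shows "n x + n y \<le> n (sup x y) + n (inf x y)"
proof (induction "\<Sum>j\<in>UNIV. x j" arbitrary: x rule: less_induct)
  case less
  show ?case
  proof (cases "x \<le> y")
    case True
    then show ?thesis by (simp add: sup_absorb2 inf_absorb1)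
  next
    case False
    then obtain i where i: "y i < x i" by (auto simp: le_fun_def not_le)
    then have x1: "1 \<le> x i" and s1: "1 \<le> sup x y i" and eq: "x i = sup x y i"
      by (simp_all add: sup_absorb1)
    have "sup (x - unit_vec i) y = sup x y - unit_vec i"
         "inf (x - unit_vec i) y = inf x y"
      using i by (auto simp: fun_eq_iff unit_vec_apply sup_nat_def inf_nat_def)
    then have "n (x - unit_vec i) + n y \<le> n (sup x y - unit_vec i) + n (inf x y)"
      using less.hyps[of "x - unit_vec i"] sum_minus_unit_vec[of x i] x1 by simp
    moreover have "d i x \<le> d i (sup x y)" by (rule mono; fact x1 sup_ge1 eq)
    ultimately show ?thesis using step[of x i] step[of "sup x y" i] x1 s1 by simp
  qed
qed

section \<open>The matricube of a set satisfying the circuit axioms\<close>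

text \<open>
  The join \<open>a\<close> of all members of \<open>C\<close> below \<open>x\<close> agrees with \<open>x\<close> in \<open>i\<close> and \<open>j\<close>. By (C3) it covers some
  \<open>b \<le> a - e\<^sub>j\<close>. If \<open>b\<close> missed the level \<open>x i\<close>, then joining it with a member of \<open>C\<close> that attains
  \<open>x j\<close> below \<open>x - e\<^sub>i\<close> would give a point strictly between \<open>b\<close> and \<open>a\<close>.
\<close>

lemma exchange:
  fixes C :: "('i::finite \<Rightarrow> nat) set"
  assumes fin: "finite C" and C3: "circuit_C3 C"
    and xi: "1 \<le> x i" and xj: "1 \<le> x j"
    and ai: "attained C i x" and aji: "attained C j (x - unit_vec i)" and ne: "i \<noteq> j"
  shows "attained C i (x - unit_vec j)"
proof -
  let ?U = "join_closure C \<union> {0}"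
  let ?S = "{c \<in> C. c \<le> x}"
  define a where "a = Sup ?S"
  obtain v where v: "v \<in> C" "v \<le> x" "v i = x i" using ai by (auto simp: attained_def)
  obtain u where u: "u \<in> C" "u \<le> x - unit_vec i" "u j = x j"
    using aji ne by (auto simp: attained_def unit_vec_apply)
  have ux: "u \<le> x" "u i < x i" using u(2) le_minus_unit_vec_iff[of x i u, OF xi] by simp_all
  have S: "finite ?S" "?S \<noteq> {}" using fin v by auto
  have aU: "a \<in> join_closure C" using S(2) unfolding a_def join_closure_def by blast
  have ax: "a \<le> x" unfolding a_def using S(2) by (intro Sup_least_fun) auto
  have va: "v \<le> a" and ua: "u \<le> a"
    unfolding a_def using S(1) u v ux by (auto intro!: Sup_upper_fun)
  have ai: "a i = x i" and aj: "a j = x j"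
    using le_funD[OF ax] le_funD[OF va, of i] le_funD[OF ua, of j] v u
    by (metis antisym)+
  obtain b where b: "b \<in> ?U" "b \<le> a - unit_vec j" "covers_in ?U a b"
    using C3 aU xj aj unfolding circuit_C3_def by metis
  have ba: "b \<le> a" "b j < a j"
    using le_minus_unit_vec_iff[of a j b] b(2) xj aj by simp_all
  show ?thesis
  proof (cases "b i = a i")
    case True
    then have "attained C i b" using b(1) join_closure_iff[OF fin, of b] xi ai by simp
    then obtain c where c: "c \<in> C" "c \<le> b" "c i = b i" by (auto simp: attained_def)
    then have "c \<le> x" "c j < x j"
      using ba ax aj le_funD[OF c(2), of j] by (auto intro: order_trans)
    then have "c \<le> x - unit_vec j" using le_minus_unit_vec_iff[of x j c, OF xj] by blast
    then show ?thesis
      using c True ai ne by (auto simp: attained_def unit_vec_apply)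
  next
    case False
    then have bi: "b i < a i" using le_funD[OF ba(1), of i] by simp
    let ?w = "sup b u"
    have "attained C k ?w" if k: "1 \<le> ?w k" for k
    proof (cases "b k \<le> u k")
      case True
      then have "u k = ?w k" by (simp add: sup_absorb2)
      then show ?thesis using u(1) unfolding attained_def by (metis sup_ge2)
    next
      case False
      then have "attained C k b" using b(1) join_closure_iff[OF fin, of b] by simp
      then obtain c where "c \<in> C" "c \<le> b" "c k = b k" by (auto simp: attained_def)
      moreover have "b k = ?w k" using False by (simp add: sup_absorb1)
      ultimately show ?thesis unfolding attained_def by (metis le_supI1)
    qed
    then have wU: "?w \<in> ?U" using join_closure_iff[OF fin] by blast
    have "?w \<le> a" using ba ua by simp
    moreover have "?w i < a i" using bi ux ai by (simp add: sup_nat_def)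
    ultimately have "?w < a" by (metis less_irrefl order_less_le)
    moreover have "?w j = x j" using u ba aj by (simp add: sup_nat_def)
    then have "b < ?w" using ba(2) aj by (metis less_irrefl order_less_le sup_ge1)
    ultimately show ?thesis using b(3) wU by (auto simp: covers_in_def)
  qed
qed

text \<open>
  If \<open>x i\<close> is not attained below \<open>x\<close>, then passing from \<open>x\<close> to \<open>x - e\<^sub>i\<close> loses no member of \<open>C\<close>, and
  similarly for \<open>j\<close>; only the case that both are attained uses (C3).
\<close>

lemma attained_square:
  fixes C :: "('i::finite \<Rightarrow> nat) set"
  assumes fin: "finite C" and C3: "circuit_C3 C"
    and ne: "i \<noteq> j" and xi: "1 \<le> x i" and xj: "1 \<le> x j"
  shows "of_bool (attained C i x) + of_bool (attained C j (x - unit_vec i))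
    = (of_bool (attained C j x) + of_bool (attained C i (x - unit_vec j)) :: int)"
proof -
  have down: "attained C l x \<Longrightarrow> \<not> attained C k x \<Longrightarrow> attained C l (x - unit_vec k)"
    if "k \<noteq> l" "1 \<le> x k" for k l
  proof -
    assume "attained C l x" and nk: "\<not> attained C k x"
    then obtain c where c: "c \<in> C" "c \<le> x" "c l = x l" by (auto simp: attained_def)
    then have "c k < x k" using nk le_funD[OF c(2), of k] by (auto simp: attained_def)
    then have "c \<le> x - unit_vec k" using le_minus_unit_vec_iff[of x k c, OF that(2)] c by blast
    then show ?thesis using c that by (auto simp: attained_def unit_vec_apply)
  qed
  have up: "attained C l (x - unit_vec k) \<Longrightarrow> attained C l x" if "k \<noteq> l" for k l
    using that minus_unit_vec_le[of x k]
    by (auto simp: attained_def unit_vec_apply intro: order_trans)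
  let ?p = "attained C i x" and ?q = "attained C j x"
  let ?pj = "attained C i (x - unit_vec j)" and ?qi = "attained C j (x - unit_vec i)"
  have "?p \<and> \<not> ?q \<longrightarrow> ?pj" "?q \<and> \<not> ?p \<longrightarrow> ?qi"
    using down[of j i] down[of i j] ne xi xj by blast+
  moreover have "?pj \<longrightarrow> ?p" "?qi \<longrightarrow> ?q"
    using up[of j i] up[of i j] ne by blast+
  moreover have "?p \<and> ?qi \<longrightarrow> ?pj" "?q \<and> ?pj \<longrightarrow> ?qi"
    using exchange[of C x i j] exchange[of C x j i] fin C3 xi xj ne by blast+
  ultimately show ?thesis by (smt (verit) of_bool_eq(1) of_bool_eq(2))
qed

lemma ex_matricube_with_cyclic_points:
  fixes C :: "('i::finite \<Rightarrow> nat) set"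
  assumes sub: "C \<subseteq> hypercuboid \<rho>" and C3: "circuit_C3 C"
  shows "\<exists>r. matricube \<rho> r \<and> cyclic_points \<rho> r = join_closure C \<union> {0}"
proof -
  have fin: "finite C" using sub finite_hypercuboid finite_subset by blast
  define d :: "'i \<Rightarrow> ('i \<Rightarrow> nat) \<Rightarrow> int" where "d i x = of_bool (attained C i x)" for i x
  define n where "n = path_sum d"
  define r where "r x = int (\<Sum>j\<in>UNIV. x j) - n x" for x
  have n_step: "n x = n (x - unit_vec i) + d i x" if "1 \<le> x i" for i x
    unfolding n_def
    using attained_square[OF fin C3] that by (intro path_sum_step) (simp_all add: d_def)
  have d_mono: "d i x \<le> d i y" if "x \<le> y" "x i = y i" for i x y
    using that by (auto simp: d_def attained_def intro: order_trans)
  have r_step: "r x = r (x - unit_vec i) + (1 - d i x)" if "1 \<le> x i" for i x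
    using n_step[of x i] sum_minus_unit_vec[of x i] that by (simp add: r_def)
  have d01: "0 \<le> d i x" "d i x \<le> 1" for i x by (simp_all add: d_def)
  have r_mono: "r x \<le> r y" if "x \<le> y" for x y
    using that
  proof (induction "\<Sum>j\<in>UNIV. y j" arbitrary: y rule: less_induct)
    case less
    show ?case
    proof (cases "x = y")
      case False
      then have "x < y" using less.prems by simp
      then obtain i where i: "1 \<le> y i" "x \<le> y - unit_vec i"
        by (rule less_imp_le_minus_unit_vec)
      then have "r x \<le> r (y - unit_vec i)"
        using less.hyps[of "y - unit_vec i"] sum_minus_unit_vec[of y i] by simp
      then show ?thesis using r_step[of y i] i(1) d01[of i y] by simp
    qed simp
  qed
  have sub_mod: "r (sup x y) + r (inf x y) \<le> r x + r y" for x y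
  proof -
    have "n x + n y \<le> n (sup x y) + n (inf x y)"
      using n_step d_mono by (intro supermodular_if_steps_mono)
    moreover have "sup x y j + inf x y j = x j + y j" for j
      by (simp add: sup_nat_def inf_nat_def)
    then have "(\<Sum>j\<in>UNIV. sup x y j) + (\<Sum>j\<in>UNIV. inf x y j)
        = (\<Sum>j\<in>UNIV. x j) + (\<Sum>j\<in>UNIV. y j)"
      unfolding sum.distrib[symmetric] by (intro sum.cong) auto
    ultimately show ?thesis unfolding r_def by linarith
  qed
  have r0: "r 0 = 0" by (simp add: r_def n_def path_sum.simps)
  have axis: "r (axis_point i t) - r (axis_point i (t - 1)) \<le> 1" if "1 \<le> t" for i t
    using r_step[of "axis_point i t" i] that d01[of i "axis_point i t"]
    by (simp add: axis_point_minus_unit_vec) (simp add: axis_point_def)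
  have "matricube \<rho> r"
    unfolding matricube_def using r0 axis r_mono sub_mod by blast
  moreover have "x \<in> cyclic_points \<rho> r \<longleftrightarrow> x \<in> join_closure C \<union> {0}" for x
  proof -
    have steps: "r (x - unit_vec i) = r x \<longleftrightarrow> attained C i x" if "1 \<le> x i" for i
      using r_step[of x i] that by (simp add: d_def)
    have "x \<in> hypercuboid \<rho>" if att: "\<forall>i. 1 \<le> x i \<longrightarrow> attained C i x"
    proof -
      have "x j \<le> \<rho> j" for j
      proof (cases "1 \<le> x j")
        case True
        then obtain c where "c \<in> C" "c j = x j" using att by (auto simp: attained_def)
        then have "c \<in> hypercuboid \<rho>" using sub by blast
        then have "c j \<le> \<rho> j" by (simp add: hypercuboid_def)
        then show ?thesis using \<open>c j = x j\<close> by simp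
      qed simp
      then show ?thesis by (simp add: hypercuboid_def)
    qed
    then show ?thesis
      unfolding join_closure_iff[OF fin] cyclic_points_def using steps by auto
  qed
  ultimately show ?thesis by blast
qed

lemma ex_matricube_with_circuits:
  fixes C :: "('i::finite \<Rightarrow> nat) set"
  assumes sub: "C \<subseteq> hypercuboid \<rho>" and ax: "circuit_C1 C" "circuit_C2 C" "circuit_C3 C"
  shows "\<exists>r. matricube \<rho> r \<and> circuits \<rho> r = C"
proof -
  obtain r where r: "matricube \<rho> r" "cyclic_points \<rho> r = join_closure C \<union> {0}"
    using ex_matricube_with_cyclic_points[OF sub ax(3)] by blast
  have "finite C" using sub finite_hypercuboid finite_subset by blast
  then have "circuits \<rho> r = C"
    unfolding circuits_eq r(2)
    using ax finite_cyclic_points[of \<rho> r] unfolding circuit_C1_def circuit_C2_def r(2)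
    by (intro irreducibles_join_closure) auto
  then show ?thesis using r(1) by blast
qed

section \<open>Simple matricubes\<close>

text \<open>
  If simplicity fails on the axis \<open>i\<close>, the first failure \<open>t\<close> makes \<open>t e\<^sub>i\<close> cyclic. Some
  circuit below it attains its \<open>i\<close>-th coordinate, and on the axis this can only be \<open>t e\<^sub>i\<close> itself.
\<close>

lemma simple_iff_Cstar:
  fixes \<rho> :: "'i::finite \<Rightarrow> nat"
  assumes m: "matricube \<rho> r" and pos: "\<And>i. 0 < \<rho> i"
  shows "simple_matricube \<rho> r \<longleftrightarrow> circuit_Cstar \<rho> (circuits \<rho> r)"
proof
  assume s: "simple_matricube \<rho> r"
  have "axis_point i t \<notin> circuits \<rho> r" if t: "t \<le> \<rho> i" for i t
  proof
    assume c: "axis_point i t \<in> circuits \<rho> r"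
    then have "t \<noteq> 0" by (auto simp: circuits_eq axis_point_0)
    then have "1 \<le> axis_point i t i" by (simp add: axis_point_def)
    then have "r (axis_point i t - unit_vec i) = r (axis_point i t)"
      using subsetD[OF circuits_subset c] by (simp add: cyclic_points_def)
    then have "r (axis_point i (t - 1)) = r (axis_point i t)"
      unfolding axis_point_minus_unit_vec .
    moreover have "r (axis_point i t) = int t" "r (axis_point i (t - 1)) = int (t - 1)"
      using s t unfolding simple_matricube_def by auto
    ultimately show False using \<open>t \<noteq> 0\<close> by simp
  qed
  then show "circuit_Cstar \<rho> (circuits \<rho> r)" by (simp add: circuit_Cstar_def)
next
  assume star: "circuit_Cstar \<rho> (circuits \<rho> r)"
  have "r (axis_point i t) = int t" if "t \<le> \<rho> i" for i t
    using that
  proof (induction t)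
    case 0
    then show ?case using m by (simp add: axis_point_0 matricube_def zero_fun_def)
  next
    case (Suc t)
    let ?x = "axis_point i (Suc t)"
    have IH: "r (axis_point i t) = int t" using Suc by simp
    have down: "?x - unit_vec i = axis_point i t" by (simp add: axis_point_minus_unit_vec)
    have Q: "?x \<in> hypercuboid \<rho>" using Suc.prems by (rule axis_point_in_hypercuboid)
    have i1: "1 \<le> ?x i" by (simp add: axis_point_def)
    have "r ?x \<noteq> int t"
    proof
      assume eq: "r ?x = int t"
      have "r (?x - unit_vec k) = r ?x" if "1 \<le> ?x k" for k
      proof -
        have "k = i" using that by (simp add: axis_point_def split: if_splits)
        then show ?thesis using eq IH down by simp
      qed
      then have "?x \<in> cyclic_points \<rho> r" using Q by (simp add: cyclic_points_def)
      then obtain c where c: "c \<in> circuits \<rho> r" "c \<le> ?x" "c i = ?x i"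
        using attained_by_irreducible[of "cyclic_points \<rho> r" ?x i] finite_cyclic_points i1
        unfolding attained_def circuits_eq by metis
      have "c j = ?x j" for j
        using c(3) le_funD[OF c(2), of j] by (cases "j = i") (simp_all add: axis_point_def)
      then have "c = ?x" by blast
      then show False using c(1) star Suc.prems by (auto simp: circuit_Cstar_def)
    qed
    moreover have "r (axis_point i t) \<le> r ?x"
      using matricube_mono[OF m hypercuboid_downward[OF Q minus_unit_vec_le] Q minus_unit_vec_le,
          of i] down by simp
    moreover have "r ?x \<le> r (axis_point i t) + 1"
      using matricube_step_le_1[OF m Q, of i] i1 down by simp
    ultimately show ?case using IH by simp
  qed
  then show "simple_matricube \<rho> r" using m pos by (simp add: simple_matricube_def)
qed

theorem theorem4p2:
  fixes \<rho> :: "'i::finite \<Rightarrow> nat"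
  shows
    "(\<forall>r. matricube \<rho> r \<longrightarrow>
        circuit_C1 (circuits \<rho> r) \<and> circuit_C2 (circuits \<rho> r) \<and> circuit_C3 (circuits \<rho> r)) \<and>
     (\<forall>C. C \<subseteq> hypercuboid \<rho> \<and> circuit_C1 C \<and> circuit_C2 C \<and> circuit_C3 C \<longrightarrow>
        (\<exists>r. matricube \<rho> r \<and> circuits \<rho> r = C)) \<and>
     ((\<forall>i. \<rho> i > 0) \<longrightarrow>
        (\<forall>r. matricube \<rho> r \<longrightarrow>
          (simple_matricube \<rho> r \<longleftrightarrow> circuit_Cstar \<rho> (circuits \<rho> r))))"
  using circuit_axioms ex_matricube_with_circuits simple_iff_Cstar by blast

end
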